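(* For any integer $n\geq 1$, we have \[ |\mathsf{BP}_n^\star| = \sum_{i=1}^{p(n)} \frac{n!}{\prod_{j=1}^{d(i)} \left(m(i,j)!\right)^j}\cdot\frac{1}{\mathrm{lcm}(i)}, \] where $\mathrm{lcm}(i)=\mathrm{lcm}(\{j\in\{1,\dots,d(i)\}\mid m(i,j)\geq 1\})$ is the least common multiple of the part sizes occurring in the $i$-th integer partition of $n$.
   Context: Notation: $\llbracket n\rrbracket=\{0,\dots,n-1\}$. A partitioned order of $\llbracket n\rrbracket$ is an (unordered) set $\{S_k\}_{k\in\llbracket s\rrbracket}$ of $s$ sequences $S_k=(i^k_0,\dots,i^k_{n_k-1})$ with $n_k>0$, each consisting of pairwise distinct elements of $\llbracket n\rrbracket$, the sequences being pairwise disjoint (as sets of entries) with union $\llbracket n\rrbracket$; so every element of $\llbracket n\rrbracket$ occurs at exactly one position of exactly one sequence. A block-parallel update mode of size $n$ is a partitioned order of $\llbracket n\rrbracket$; its sequences are called o-blocks. The set of all of them is $\mathsf{BP}_n$. For $\mu=\{S_k\}_{k\in\llbracket s\rrbracket}\in\mathsf{BP}_n$, let $p=\mathrm{lcm}(n_0,\dots,n_{s-1})$ and define the sequence of blocks $\varphi(\mu)=(W_\ell)_{\ell\in\llbracket p\rrbracket}$ by $W_\ell=\{i^k_{\ell \bmod n_k}\mid k\in\llbracket s\rrbracket\}$; write $|\varphi(\mu)|=p$ for its length. Equivalence: $\sigma^i$ denotes the circular shift of order $i\in\mathbb{Z}$ on finite sequences, moving the element at position $0$ to position $i$ (positions modulo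 the length). For $\mu,\mu'\in\mathsf{BP}_n$, $\mu\equiv_\star\mu'$ means $\varphi(\mu)=\sigma^i(\varphi(\mu'))$ for some $i\in\llbracket|\varphi(\mu')|\rrbracket$. $\mathsf{BP}_n^\star=\mathsf{BP}_n/\equiv_\star$ is the quotient set. Integer partitions: $p(n)$ is the number of integer partitions of $n$ (multisets of positive integers summing to $n$), listed in some fixed order as partitions number $1,\dots,p(n)$; $d(i)$ is the maximal part size of the $i$-th partition, and $m(i,j)$ is the multiplicity of the part of size $j$ in the $i$-th partition (possibly $0$). *)

theory Defs
  imports Complex_Main "HOL-Library.Multiset" "HOL-Library.Disjoint_Sets"
begin

text \<open>Since o-blocks are nonempty and pairwise disjoint, the \<open>S\<^sub>k\<close> of a partitioned order
  are pairwise distinct, so the order is represented by a plain set of lists.\<close>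

definition BP :: "nat \<Rightarrow> nat list set set" where
  "BP n = {\<mu>. (\<forall>S\<in>\<mu>. S \<noteq> [] \<and> distinct S) \<and> disjoint_family_on set \<mu> \<and> (\<Union>S\<in>\<mu>. set S) = {..<n}}"

definition \<phi> :: "nat list set \<Rightarrow> nat set list" where
  "\<phi> \<mu> = map (\<lambda>l. {S ! (l mod length S) | S. S \<in> \<mu>}) [0..<Lcm (length ` \<mu>)]"

text \<open>The element at position \<open>0\<close> moves to position \<open>i\<close>, that is, entries move to the right
  for positive \<open>i\<close>, whereas \<^const>\<open>rotate\<close> moves them to the left.\<close>

definition circ_shift :: "int \<Rightarrow> 'a list \<Rightarrow> 'a list" where
  "circ_shift i xs = rotate (nat ((- i) mod int (length xs))) xs"

lemma circ_shift_nth: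
  assumes "l < length xs"
  shows "circ_shift i xs ! nat ((int l + i) mod int (length xs)) = xs ! l"
proof -
  let ?n = "int (length xs)"
  have n: "?n > 0" using assms by linarith
  have lt: "nat ((int l + i) mod ?n) < length xs"
    using n by (simp add: nat_less_iff)
  have "int ((nat ((int l + i) mod ?n) + nat ((- i) mod ?n)) mod length xs)
      = ((int l + i) mod ?n + (- i) mod ?n) mod ?n"
    using n by (simp add: zmod_int)
  also have "\<dots> = int l"
    using assms by (simp add: mod_simps)
  finally have "(nat ((int l + i) mod ?n) + nat ((- i) mod ?n)) mod length xs = l"
    by linarith
  then show ?thesis
    unfolding circ_shift_def using lt by (simp add: nth_rotate add.commute)
qed

definition equiv_star :: "nat \<Rightarrow> (nat list set \<times> nat list set) set" where
  "equiv_star n = {(\<mu>, \<mu>'). \<mu> \<in> BP n \<and> \<mu>' \<in> BP n \<and>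
     (\<exists>i<length (\<phi> \<mu>'). \<phi> \<mu> = circ_shift (int i) (\<phi> \<mu>'))}"

definition BP_star :: "nat \<Rightarrow> nat list set set set" where
  "BP_star n = BP n // equiv_star n"

definition int_partitions :: "nat \<Rightarrow> nat multiset set" where
  "int_partitions n = {P. (\<forall>j\<in>#P. j > 0) \<and> sum_mset P = n}"

lemma finite_BP: "finite (BP n)"
proof -
  have "BP n \<subseteq> Pow {S. set S \<subseteq> {..<n} \<and> distinct S}"
    unfolding BP_def by blast
  moreover have "finite {S. set S \<subseteq> {..<n} \<and> distinct S}"
    using finite_subset_distinct[of "{..<n}"] by simp
  ultimately show ?thesis by (meson finite_Pow_iff finite_subset)
qed

lemma length_phi_pos:
  assumes "\<mu> \<in> BP n"
  shows "0 < length (\<phi> \<mu>)"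
proof -
  have "\<mu> \<subseteq> {S. set S \<subseteq> {..<n} \<and> distinct S}"
    using assms unfolding BP_def by blast
  then have "finite \<mu>"
    using finite_subset_distinct[of "{..<n}"] finite_subset by auto
  moreover have "0 \<notin> length ` \<mu>"
    using assms unfolding BP_def by auto
  ultimately have "Lcm (length ` \<mu>) \<noteq> 0"
    by (subst Lcm_0_iff) auto
  then show ?thesis unfolding \<phi>_def by simp
qed

lemma ex_circ_shift_iff:
  assumes "xs \<noteq> []"
  shows "(\<exists>i<length xs. ys = circ_shift (int i) xs) \<longleftrightarrow> (\<exists>m. ys = rotate m xs)"
proof
  assume "\<exists>m. ys = rotate m xs"
  then obtain m where m: "ys = rotate m xs" by blast
  let ?n = "int (length xs)"
  let ?i = "nat ((- int m) mod ?n)"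
  have n: "?n > 0" using assms by simp
  have "(- int ?i) mod ?n = int m mod ?n"
    using n by (simp add: mod_simps)
  then have "circ_shift (int ?i) xs = rotate (m mod length xs) xs"
    unfolding circ_shift_def by (simp flip: zmod_int)
  then have "ys = circ_shift (int ?i) xs"
    using m by (simp flip: rotate_conv_mod)
  moreover have "?i < length xs" using n by (simp add: nat_less_iff)
  ultimately show "\<exists>i<length xs. ys = circ_shift (int i) xs" by blast
qed (auto simp: circ_shift_def)

lemma equiv_equiv_star: "equiv (BP n) (equiv_star n)"
proof -
  have eq: "equiv_star n = {(\<mu>, \<mu>'). \<mu> \<in> BP n \<and> \<mu>' \<in> BP n \<and> (\<exists>m. \<phi> \<mu> = rotate m (\<phi> \<mu>'))}"
    unfolding equiv_star_def using length_phi_pos ex_circ_shift_iff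
    by (metis (no_types, lifting) length_greater_0_conv)
  have inv: "\<exists>k. xs = rotate k (rotate m xs)" for m and xs :: "nat set list"
  proof -
    have "rotate (length xs - m mod length xs) (rotate (m mod length xs) xs) = xs"
      by (cases "xs = []") (simp_all add: rotate_rotate less_imp_le)
    then show ?thesis by (metis rotate_conv_mod)
  qed
  show ?thesis
  proof (rule equivI)
    show "equiv_star n \<subseteq> BP n \<times> BP n" by (auto simp: eq)
    show "refl_on (BP n) (equiv_star n)"
      by (auto simp: eq refl_on_def intro: exI[of _ 0])
    show "sym (equiv_star n)"
      using inv by (auto simp: eq sym_def)
    show "trans (equiv_star n)"
      by (auto simp: eq trans_def rotate_rotate)
  qed
qed

lemma finite_int_partitions: "finite (int_partitions n)"
proof -
  have "int_partitions n \<subseteq> mset ` {xs. set xs \<subseteq> {..n} \<and> length xs \<le> n}"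
  proof
    fix P assume P: "P \<in> int_partitions n"
    obtain xs where xs: "P = mset xs" by (metis ex_mset)
    have pos: "\<forall>j\<in>set xs. j > 0" and sum: "sum_list xs = n"
      using P xs by (auto simp: int_partitions_def sum_mset_sum_list)
    have "set xs \<subseteq> {..n}" using member_le_sum_list sum by blast
    moreover have "length xs \<le> sum_list xs"
      using pos by (induction xs) auto
    ultimately show "P \<in> mset ` {xs. set xs \<subseteq> {..n} \<and> length xs \<le> n}"
      using xs sum by blast
  qed
  then show ?thesis
    using finite_lists_length_le[of "{..n}" n] finite_subset by blast
qed

end

(* An element x of an o-block is labelled with the length j of its block and its position r < j.
   Since W_l consists of the elements whose label (j, r) satisfies r = l mod j, the list of the
   labels of 0, ..., n - 1 determines phi(mu), and rotating phi(mu) amounts to shifting all labels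
   (j, r) to (j, (r + m) mod j). If P is the partition of n given by the block lengths, the possible
   lists of labels are the arrangements of the multiset containing (j, r) with multiplicity m(j)
   for every r < j: this gives n! / prod (m(j)!)^j of them. Shifting acts on them with all orbits
   of size lcm(P), since a shift by m fixes a list only if every part of P divides m. *)

theory Submission
  imports Defs "HOL-Combinatorics.Multiset_Permutations" "HOL-Number_Theory.Cong"
begin

section \<open>Labels, cells and the shift action\<close>

text \<open>The description has a unique solution only for an \<open>x\<close> occurring in some
  block; for \<open>\<mu> \<in> BP n\<close> this means \<open>x < n\<close>, and
  \<open>label\<close> is evaluated only there.\<close>

definition label :: "nat list set \<Rightarrow> nat \<Rightarrow> nat \<times> nat" where
  "label \<mu> x = (THE p. \<exists>S\<in>\<mu>. \<exists>r<length S. S ! r = x \<and> p = (length S, r))"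

definition code :: "nat \<Rightarrow> nat list set \<Rightarrow> (nat \<times> nat) list" where
  "code n \<mu> = map (label \<mu>) [0..<n]"

definition cells :: "nat multiset \<Rightarrow> (nat \<times> nat) multiset" where
  "cells P = (\<Sum>j\<in>#P. mset (map (Pair j) [0..<j]))"

definition shift :: "nat \<Rightarrow> nat \<times> nat \<Rightarrow> nat \<times> nat" where
  "shift m = (\<lambda>(j, r). (j, (r + m) mod j))"

text \<open>Natural shifts suffice for a group orbit: a shift by \<open>m\<close> is undone by a
  further shift that completes a common multiple of all block lengths.\<close>

definition orbit :: "(nat \<times> nat) list \<Rightarrow> (nat \<times> nat) list set" where
  "orbit c = range (\<lambda>m. map (shift m) c)"

section \<open>Counting the arrangements of the cells\<close>

lemma count_cells: "count (cells P) (j, r) = (if r < j then count P j else 0)"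
proof (induction P)
  case (add i P)
  have "count (mset (map (Pair i) [0..<i])) (j, r) = (if i = j \<and> r < j then 1 else 0)"
    by (subst distinct_count_atmost_1[THEN iffD1, rule_format]) (auto simp: distinct_map inj_on_def)
  then show ?case using add by (simp add: cells_def)
qed (simp add: cells_def)

lemma size_cells: "size (cells P) = sum_mset P"
  by (induction P) (auto simp: cells_def)

lemma set_mset_cells: "set_mset (cells P) = Sigma (set_mset P) (\<lambda>j. {..<j})"
proof -
  have "p \<in># cells P \<longleftrightarrow> fst p \<in># P \<and> snd p < fst p" for p
    by (cases p) (auto simp: count_greater_zero_iff[symmetric] count_cells simp del: count_greater_zero_iff)
  then show ?thesis by auto
qed

text \<open>The multiplicity of \<open>j\<close> is read off at the cell \<open>(j, 0)\<close>. A
  part 0 leaves no cell at all, so positivity of the parts is essential.\<close>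

lemma cells_inj_on: "inj_on cells (int_partitions n)"
proof (rule inj_onI, rule multiset_eqI)
  fix P Q j assume "P \<in> int_partitions n" "Q \<in> int_partitions n" and eq: "cells P = cells Q"
  then have "0 \<notin># P" "0 \<notin># Q" by (auto simp: int_partitions_def)
  moreover have "count (cells P) (j, 0) = count (cells Q) (j, 0)" by (simp add: eq)
  ultimately show "count P j = count Q j" by (cases "j = 0") (auto simp: count_cells not_in_iff)
qed

text \<open>This is a multinomial coefficient: a part size \<open>j\<close> yields \<open>j\<close>
  different labels, each repeated \<open>count P j\<close> times, which explains the
  exponent.\<close>

lemma card_permutations_of_cells:
  "real (card (permutations_of_multiset (cells P))) =
    fact (sum_mset P) / (\<Prod>j\<in>set_mset P. fact (count P j) ^ j)"
proof -
  have "(\<Prod>x\<in>set_mset (cells P). fact (count (cells P) x) :: nat) =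
    (\<Prod>j\<in>set_mset P. \<Prod>r<j. fact (count (cells P) (j, r)))"
    unfolding set_mset_cells by (subst prod.Sigma) auto
  also have "\<dots> = (\<Prod>j\<in>set_mset P. fact (count P j) ^ j)"
    by (rule prod.cong) (auto simp: count_cells)
  finally have eq: "(\<Prod>x\<in>set_mset (cells P). fact (count (cells P) x) :: nat) =
    (\<Prod>j\<in>set_mset P. fact (count P j) ^ j)" .
  \<comment> \<open>Divisibility lets the \<open>div\<close> in the count of arrangements become a
    division of reals.\<close>
  have dvd: "(\<Prod>j\<in>set_mset P. fact (count P j) ^ j :: nat) dvd fact (sum_mset P)"
    using card_permutations_of_multiset(2)[of "cells P"] by (simp add: eq size_cells)
  have "card (permutations_of_multiset (cells P)) =
      fact (sum_mset P) div (\<Prod>j\<in>set_mset P. fact (count P j) ^ j)"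
    using card_permutations_of_multiset(1)[of "cells P"] by (simp add: eq size_cells)
  then show ?thesis using dvd by (simp add: real_of_nat_div)
qed

section \<open>Labels of the elements of a partitioned order\<close>

text \<open>A shared entry forces two blocks to coincide by disjointness, and then two positions to
  coincide by distinctness.\<close>

lemma label_nth:
  assumes "\<mu> \<in> BP n" "S \<in> \<mu>" "r < length S"
  shows "label \<mu> (S ! r) = (length S, r)"
  unfolding label_def
proof (rule the_equality)
  show "\<exists>S'\<in>\<mu>. \<exists>r'<length S'. S' ! r' = S ! r \<and> (length S, r) = (length S', r')"
    using assms by blast
next
  fix p assume "\<exists>S'\<in>\<mu>. \<exists>r'<length S'. S' ! r' = S ! r \<and> p = (length S', r')"
  then obtain S' r' where S': "S' \<in> \<mu>" "r' < length S'" "S' ! r' = S ! r" "p = (length S', r')"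
    by blast
  have "S ! r \<in> set S \<inter> set S'" using S' assms by (metis IntI nth_mem)
  then have "S' = S"
    using assms S' unfolding BP_def disjoint_family_on_def by blast
  then show "p = (length S, r)"
    using S' assms unfolding BP_def by (auto simp: nth_eq_iff_index_eq)
qed

lemma BP_nth_lt:
  assumes "\<mu> \<in> BP n" "S \<in> \<mu>" "r < length S"
  shows "S ! r < n"
  using assms nth_mem unfolding BP_def by blast

lemma BP_coverE:
  assumes "\<mu> \<in> BP n" "x < n"
  obtains S r where "S \<in> \<mu>" "r < length S" "S ! r = x"
proof -
  have "x \<in> (\<Union>S\<in>\<mu>. set S)" using assms unfolding BP_def by auto
  then show ?thesis using that by (auto simp: in_set_conv_nth)
qed

lemma finite_in_BP: "\<mu> \<in> BP n \<Longrightarrow> finite \<mu>"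
proof -
  assume "\<mu> \<in> BP n"
  then have "\<mu> \<subseteq> {S. set S \<subseteq> {..<n} \<and> distinct S}" unfolding BP_def by blast
  then show ?thesis using finite_subset_distinct[of "{..<n}"] finite_subset by auto
qed

lemma label_bounds:
  assumes "\<mu> \<in> BP n" "x < n"
  shows "snd (label \<mu> x) < fst (label \<mu> x)" "fst (label \<mu> x) \<in> length ` \<mu>"
  using assms by (auto elim!: BP_coverE simp: label_nth[OF assms(1)])

text \<open>Makes the length of \<open>\<phi> \<mu>\<close>, an \<open>Lcm\<close> of block lengths,
  computable from the code. No block is missed, since each has an entry at position 0.\<close>

lemma lengths_eq_labels:
  assumes "\<mu> \<in> BP n"
  shows "length ` \<mu> = fst ` set (code n \<mu>)"
proof -
  have "length S \<in> (\<lambda>x. fst (label \<mu> x)) ` {0..<n}" if "S \<in> \<mu>" for S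
  proof (rule image_eqI)
    have "0 < length S" using that assms by (auto simp: BP_def)
    then show "length S = fst (label \<mu> (S ! 0))" "S ! 0 \<in> {0..<n}"
      using that assms by (auto simp: label_nth BP_nth_lt)
  qed
  then show ?thesis using label_bounds(2)[OF assms] by (auto simp: code_def image_image)
qed

section \<open>Rotations of \<open>\<phi> \<mu>\<close> as shifts of labels\<close>

text \<open>A block of length \<open>j\<close> contributes exactly its entry at position
  \<open>l mod j\<close>, so the labels alone tell which elements occur at index
  \<open>l\<close>.\<close>

lemma nth_phi:
  assumes "\<mu> \<in> BP n" "l < length (\<phi> \<mu>)"
  shows "\<phi> \<mu> ! l = {x. x < n \<and> snd (label \<mu> x) = l mod fst (label \<mu> x)}"
proof -
  have "\<phi> \<mu> ! l = {S ! (l mod length S) | S. S \<in> \<mu>}"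
    using assms(2) by (simp add: \<phi>_def)
  also have "\<dots> = {x. x < n \<and> snd (label \<mu> x) = l mod fst (label \<mu> x)}"
  proof (intro set_eqI iffI)
    fix x assume "x \<in> {S ! (l mod length S) | S. S \<in> \<mu>}"
    then obtain S where S: "S \<in> \<mu>" "x = S ! (l mod length S)" by blast
    then have "l mod length S < length S" using assms(1) by (auto simp: BP_def)
    then show "x \<in> {x. x < n \<and> snd (label \<mu> x) = l mod fst (label \<mu> x)}"
      using S assms(1) by (auto simp: label_nth BP_nth_lt)
  next
    fix x assume x: "x \<in> {x. x < n \<and> snd (label \<mu> x) = l mod fst (label \<mu> x)}"
    then obtain S r where "S \<in> \<mu>" "r < length S" "S ! r = x" using assms(1) BP_coverE by blast
    with x show "x \<in> {S ! (l mod length S) | S. S \<in> \<mu>}" using assms(1) by (auto simp: label_nth)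
  qed
  finally show ?thesis .
qed

text \<open>The residue class of the positions at which an element occurs determines its label.\<close>

lemma residue_class_eqD:
  fixes j j' r r' m L :: nat
  assumes "r < j" "r' < j'" "j dvd L" "j' dvd L" "L > 0"
    and eq: "\<And>l. l < L \<Longrightarrow> r = l mod j \<longleftrightarrow> r' = (l + m) mod L mod j'"
  shows "j' = j \<and> r' = (r + m) mod j"
proof -
  \<comment> \<open>Both \<open>j\<close> and \<open>j'\<close> divide \<open>L\<close>, so reducing
    an index modulo \<open>L\<close> changes neither residue and the equivalence extends to all
    \<open>l\<close>.\<close>
  have eq': "r = l mod j \<longleftrightarrow> r' = (l + m) mod j'" for l
  proof -
    have "r = l mod L mod j \<longleftrightarrow> r' = (l mod L + m) mod L mod j'" using eq assms by simp
    then show ?thesis using assms by (simp only: mod_mod_cancel mod_add_left_eq)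
  qed
  \<comment> \<open>The indices \<open>r\<close>, \<open>r + j\<close> and \<open>r + j'\<close> are
    tested. The first two give \<open>j' dvd j\<close>; the third, with the equivalence read
    backwards, gives \<open>j dvd j'\<close>.\<close>
  have r: "r' = (r + m) mod j'" using eq'[of r] assms by simp
  have "r' = (r + j + m) mod j'" using eq'[of "r + j"] assms by simp
  with r have "(r + j + m) mod j' = (r + m) mod j'" by simp
  then have "j' dvd j" by (subst (asm) mod_eq_dvd_iff_nat) auto
  moreover have "r' = (r + j' + m) mod j'" using r by (simp add: add.assoc add.left_commute[of r])
  then have "(r + j') mod j = r mod j" using eq' assms(1) by (metis mod_less)
  then have "j dvd j'" by (subst (asm) mod_eq_dvd_iff_nat) auto
  ultimately have "j' = j" by (rule dvd_antisym)
  then show ?thesis using r by simp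
qed

text \<open>Since \<open>rotate\<close> moves entries to the left, index \<open>l\<close> of
  \<open>\<phi> \<mu>\<close> is index \<open>l + m\<close> of \<open>\<phi> \<mu>'\<close>,
  cyclically. Position \<open>r\<close> in \<open>\<mu>\<close> thus becomes \<open>r + m\<close> in
  \<open>\<mu>'\<close>, so the shift runs from \<open>\<mu>\<close> to \<open>\<mu>'\<close>,
  opposite to the rotation.\<close>

lemma phi_rotate_iff:
  assumes "\<mu> \<in> BP n" "\<mu>' \<in> BP n"
  shows "\<phi> \<mu> = rotate m (\<phi> \<mu>') \<longleftrightarrow> code n \<mu>' = map (shift m) (code n \<mu>)"
proof
  let ?L = "length (\<phi> \<mu>)"
  assume rot: "\<phi> \<mu> = rotate m (\<phi> \<mu>')"
  then have len: "length (\<phi> \<mu>') = ?L" by simp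
  have "label \<mu>' x = shift m (label \<mu> x)" if x: "x < n" for x
  proof -
    obtain j r j' r' where lab: "label \<mu> x = (j, r)" "label \<mu>' x = (j', r')" by fastforce
    have "j' = j \<and> r' = (r + m) mod j"
    proof (rule residue_class_eqD)
      show "r < j" "r' < j'" using assms[THEN label_bounds(1), OF x] lab by auto
      show "j dvd ?L" "j' dvd ?L"
        using assms[THEN label_bounds(2), OF x, THEN dvd_Lcm] lab len by (auto simp: \<phi>_def)
      show "?L > 0" using length_phi_pos assms by blast
      fix l assume l: "l < ?L"
      then have "0 < ?L" by linarith
      then have l': "(l + m) mod ?L < length (\<phi> \<mu>')" unfolding len by (rule mod_less_divisor)
      have "\<phi> \<mu> ! l = \<phi> \<mu>' ! ((l + m) mod ?L)"
        using l by (subst rot) (simp add: nth_rotate len add.commute)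
      then have "x \<in> \<phi> \<mu> ! l \<longleftrightarrow> x \<in> \<phi> \<mu>' ! ((l + m) mod ?L)" by simp
      then show "r = l mod j \<longleftrightarrow> r' = (l + m) mod ?L mod j'"
        using x lab by (simp add: nth_phi[OF assms(1) l] nth_phi[OF assms(2) l'])
    qed
    then show ?thesis by (simp add: lab shift_def)
  qed
  then show "code n \<mu>' = map (shift m) (code n \<mu>)" by (simp add: code_def)
next
  assume eq: "code n \<mu>' = map (shift m) (code n \<mu>)"
  let ?L = "length (\<phi> \<mu>)"
  \<comment> \<open>Shifts keep block lengths, so both sequences have the same \<open>Lcm\<close> as
    length.\<close>
  have "fst ` set (code n \<mu>') = fst ` set (code n \<mu>)"
    unfolding eq by (auto simp: shift_def image_image split: prod.splits intro: rev_image_eqI)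
  then have len: "length (\<phi> \<mu>') = ?L" using assms lengths_eq_labels by (simp add: \<phi>_def)
  have lab: "label \<mu>' x = shift m (label \<mu> x)" if "x < n" for x
    using eq that by (auto simp: code_def)
  show "\<phi> \<mu> = rotate m (\<phi> \<mu>')"
  proof (rule nth_equalityI)
    fix l assume l: "l < ?L"
    then have "0 < ?L" by linarith
    then have l': "(l + m) mod ?L < length (\<phi> \<mu>')" unfolding len by (rule mod_less_divisor)
    \<comment> \<open>As \<open>j\<close> divides \<open>?L\<close>, the wrap-around modulo
      \<open>?L\<close> disappears modulo \<open>j\<close>, and the common summand \<open>m\<close>
      cancels.\<close>
    have "snd (label \<mu> x) = l mod fst (label \<mu> x) \<longleftrightarrow>
      snd (label \<mu>' x) = (l + m) mod ?L mod fst (label \<mu>' x)" if x: "x < n" for x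
    proof -
      obtain j r where jr: "label \<mu> x = (j, r)" by fastforce
      have "r < j" "j dvd ?L" using label_bounds[OF assms(1) x] jr by (auto simp: \<phi>_def)
      moreover have "(r + m) mod j = (l + m) mod j \<longleftrightarrow> r mod j = l mod j"
        by (metis cong_add_rcancel_nat cong_def)
      ultimately show ?thesis using x jr by (simp add: lab shift_def mod_mod_cancel)
    qed
    then have "\<phi> \<mu> ! l = \<phi> \<mu>' ! ((l + m) mod ?L)"
      by (auto simp: nth_phi[OF assms(1) l] nth_phi[OF assms(2) l'])
    then show "\<phi> \<mu> ! l = rotate m (\<phi> \<mu>') ! l"
      using l by (simp add: nth_rotate len add.commute)
  qed (simp add: len)
qed

section \<open>The codes are exactly the arrangements of cells\<close>

lemma count_mset_conv_card_nth: "count (mset xs) y = card {i. i < length xs \<and> xs ! i = y}"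
  unfolding count_mset count_list_eq_length_filter length_filter_conv_card
  by (rule arg_cong[where f = card]) auto

lemma count_mset_code: "count (mset (code n \<mu>)) p = card {x. x < n \<and> label \<mu> x = p}"
proof -
  have "count (mset (code n \<mu>)) p = card {x. x < length (code n \<mu>) \<and> code n \<mu> ! x = p}"
    by (rule count_mset_conv_card_nth)
  also have "{x. x < length (code n \<mu>) \<and> code n \<mu> ! x = p} = {x. x < n \<and> label \<mu> x = p}"
    by (auto simp: code_def)
  finally show ?thesis .
qed

text \<open>The partition is that of the block lengths. For \<open>r < j\<close>, sending a block of
  length \<open>j\<close> to its entry at \<open>r\<close> matches these blocks with the elements
  labelled \<open>(j, r)\<close>, so this label occurs \<open>count P j\<close> times.\<close>

lemma code_in_permutations:
  assumes "\<mu> \<in> BP n"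
  shows "\<exists>P\<in>int_partitions n. code n \<mu> \<in> permutations_of_multiset (cells P)"
proof -
  define P where "P = image_mset length (mset_set \<mu>)"
  have fin: "finite \<mu>" using assms by (rule finite_in_BP)
  have mset: "mset (code n \<mu>) = cells P"
  proof (rule multiset_eqI)
    fix p :: "nat \<times> nat"
    obtain j r where p: "p = (j, r)" by fastforce
    show "count (mset (code n \<mu>)) p = count (cells P) p"
    proof (cases "r < j")
      case True
      have "bij_betw (\<lambda>S. S ! r) {S \<in> \<mu>. length S = j} {x. x < n \<and> label \<mu> x = p}"
      proof (rule bij_betwI')
        fix S T assume S: "S \<in> {S \<in> \<mu>. length S = j}" and T: "T \<in> {S \<in> \<mu>. length S = j}"
        show "S ! r = T ! r \<longleftrightarrow> S = T"
        proof
          assume "S ! r = T ! r"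
          then have "S ! r \<in> set S \<inter> set T" using S T True by (metis (lifting) IntI mem_Collect_eq nth_mem)
          then show "S = T" using S T assms unfolding BP_def disjoint_family_on_def by blast
        qed simp
      next
        fix x assume "x \<in> {x. x < n \<and> label \<mu> x = p}"
        then have "x < n" "label \<mu> x = (j, r)" using p by auto
        then show "\<exists>S\<in>{S \<in> \<mu>. length S = j}. x = S ! r"
            using assms by (auto elim!: BP_coverE simp: label_nth[OF assms])
      qed (use True assms p in \<open>auto simp: label_nth BP_nth_lt\<close>)
      then have "card {x. x < n \<and> label \<mu> x = p} = card {S \<in> \<mu>. length S = j}"
        by (simp add: bij_betw_same_card)
      also have "\<dots> = count P j"
        using fin by (simp add: P_def count_image_mset' eq_commute)
      finally show ?thesis using True by (simp add: p count_cells count_mset_code)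
    next
      case False
      then have "{x. x < n \<and> label \<mu> x = p} = {}" using label_bounds(1)[OF assms] p by force
      then show ?thesis using False by (simp add: p count_cells count_mset_code)
    qed
  qed
  have "sum_mset P = n" using arg_cong[OF mset, of size] by (simp add: size_cells code_def)
  moreover have "\<forall>j\<in>#P. j > 0" using assms fin by (auto simp: P_def BP_def)
  ultimately have "P \<in> int_partitions n" by (simp add: int_partitions_def)
  then show ?thesis using mset by (auto simp: permutations_of_multiset_def)
qed

text \<open>For fixed \<open>j\<close>, the positions of \<open>c\<close> fall into classes for the
  labels \<open>(j, 0)\<close> to \<open>(j, j - 1)\<close>, all of size \<open>count P j\<close>.
  After an arbitrary numbering of each class, the \<open>k\<close>-th block of length
  \<open>j\<close> takes the \<open>k\<close>-th member of every class.\<close>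

lemma permutation_in_code_image:
  assumes P: "P \<in> int_partitions n" and c: "c \<in> permutations_of_multiset (cells P)"
  shows "c \<in> code n ` BP n"
proof -
  have mset: "mset c = cells P" using c by (simp add: permutations_of_multiset_def)
  have len: "length c = n"
    using arg_cong[OF mset, of size] P by (simp add: size_cells int_partitions_def)
  define X where "X j r = {x. x < n \<and> c ! x = (j, r)}" for j r
  have card_X: "card (X j r) = count P j" if "r < j" for j r
  proof -
    have "card (X j r) = count (mset c) (j, r)"
      by (simp add: X_def count_mset_conv_card_nth len)
    then show ?thesis using that by (simp add: mset count_cells)
  qed
  \<comment> \<open>The condition \<open>r < j\<close> sits under the quantifier so that a single
    choice function \<open>b\<close> serves all classes; for \<open>r \<ge> j\<close> nothing is
    claimed.\<close>
  have "\<forall>j r. \<exists>b. r < j \<longrightarrow> bij_betw b {..<count P j} (X j r)"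
  proof (intro allI)
    fix j r
    have "finite (X j r)" by (simp add: X_def)
    then show "\<exists>b. r < j \<longrightarrow> bij_betw b {..<count P j} (X j r)"
      using card_X[of r j] finite_same_card_bij[of "{..<count P j}" "X j r"] by auto
  qed
  then obtain b where b: "\<And>j r. r < j \<Longrightarrow> bij_betw (b j r) {..<count P j} (X j r)" by metis
  define B where "B j k = map (\<lambda>r. b j r k) [0..<j]" for j k
  define \<mu> where "\<mu> = {B j k | j k. k < count P j}"
  have b_in: "b j r k < n" "c ! b j r k = (j, r)" if "r < j" "k < count P j" for j r k
    using bij_betw_apply[OF b[OF that(1)], of k] that by (auto simp: X_def)
  have b_ex: "\<exists>j r k. r < j \<and> k < count P j \<and> c ! x = (j, r) \<and> b j r k = x" if "x < n" for x
  proof -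
    obtain j r where jr: "c ! x = (j, r)" by fastforce
    have "c ! x \<in> set_mset (mset c)" using that len by simp
    then have "r < j" by (simp add: mset set_mset_cells jr)
    moreover from this have "x \<in> b j r ` {..<count P j}"
      using that jr by (simp add: bij_betw_imp_surj_on[OF b] X_def)
    ultimately show ?thesis using jr by fastforce
  qed
  have BP: "\<mu> \<in> BP n"
    unfolding BP_def
  proof (intro CollectI conjI ballI)
    fix S assume "S \<in> \<mu>"
    then obtain j k where S: "S = B j k" "k < count P j" by (auto simp: \<mu>_def)
    then have "j \<in># P" by (metis count_greater_zero_iff gr_zeroI not_less_zero)
    then show "S \<noteq> []" using P S by (auto simp: int_partitions_def B_def)
    show "distinct S"
      using S b_in(2) by (auto simp: B_def distinct_map inj_on_def) (metis snd_conv)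
  next
    show "disjoint_family_on set \<mu>"
      unfolding disjoint_family_on_def
    proof (intro ballI impI)
      fix S T assume S: "S \<in> \<mu>" and T: "T \<in> \<mu>" and ne: "S \<noteq> T"
      obtain j k where S: "S = B j k" "k < count P j" using S by (auto simp: \<mu>_def)
      obtain i l where T: "T = B i l" "l < count P i" using T by (auto simp: \<mu>_def)
      show "set S \<inter> set T = {}"
      proof (rule ccontr)
        assume "set S \<inter> set T \<noteq> {}"
        then obtain r s where rs: "r < j" "s < i" "b j r k = b i s l"
          using S T by (auto simp: B_def)
        \<comment> \<open>A common element has a single label in \<open>c\<close>, which fixes
          length and position; injectivity of the numbering of that class then fixes the
          block.\<close>
        then have "j = i \<and> r = s" using b_in(2) S T by (metis Pair_inject)
        moreover from this have "k = l"
          using rs S T bij_betw_imp_inj_on[OF b[OF rs(1)]] by (auto simp: inj_on_def)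
        ultimately show False using ne S T by simp
      qed
    qed
  next
    show "(\<Union>S\<in>\<mu>. set S) = {..<n}"
    proof (intro set_eqI iffI)
      fix x assume "x \<in> {..<n}"
      then obtain j r k where "r < j" "k < count P j" "b j r k = x" using b_ex by blast
      then have "B j k \<in> \<mu>" "x \<in> set (B j k)" by (auto simp: \<mu>_def B_def)
      then show "x \<in> (\<Union>S\<in>\<mu>. set S)" by blast
    qed (auto simp: \<mu>_def B_def b_in)
  qed
  have "code n \<mu> = c"
  proof (rule nth_equalityI)
    fix x assume "x < length (code n \<mu>)"
    then have x: "x < n" by (simp add: code_def)
    then obtain j r k where k: "r < j" "k < count P j" "c ! x = (j, r)" "b j r k = x"
      using b_ex by blast
    then have "B j k \<in> \<mu>" "B j k ! r = x" "length (B j k) = j" by (auto simp: \<mu>_def B_def)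
    then have "label \<mu> x = (j, r)" using label_nth[OF BP] k by fastforce
    then show "code n \<mu> ! x = c ! x" using x k by (simp add: code_def)
  qed (simp add: code_def len)
  then show ?thesis using BP by blast
qed

lemma code_image_BP:
  "code n ` BP n = (\<Union>P\<in>int_partitions n. permutations_of_multiset (cells P))"
proof
  show "code n ` BP n \<subseteq> (\<Union>P\<in>int_partitions n. permutations_of_multiset (cells P))"
    using code_in_permutations by fastforce
  show "(\<Union>P\<in>int_partitions n. permutations_of_multiset (cells P)) \<subseteq> code n ` BP n"
    by (intro UN_least subsetI) (rule permutation_in_code_image)
qed

section \<open>Orbits of the shift action\<close>

lemma shift_shift: "shift m (shift k p) = shift (k + m) p"
  by (cases p) (simp add: shift_def mod_simps add.assoc)

lemma shift_mod: "fst p dvd L \<Longrightarrow> shift (m mod L) p = shift m p"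
proof -
  assume "fst p dvd L"
  moreover obtain j r where "p = (j, r)" by fastforce
  ultimately have "(r + m mod L) mod j = (r + m) mod j"
    by (metis fst_conv mod_add_right_eq mod_mod_cancel)
  then show ?thesis using \<open>p = (j, r)\<close> by (simp add: shift_def)
qed

lemma set_permutation_of_cells:
  assumes "c \<in> permutations_of_multiset (cells P)"
  shows "set c = Sigma (set_mset P) (\<lambda>j. {..<j})"
  using assms set_mset_cells by (metis permutations_of_multisetD set_mset_mset)

text \<open>A finite set has \<open>Lcm\<close> 0 only if it contains 0; the empty partition gives
  1.\<close>

lemma Lcm_parts_pos: "P \<in> int_partitions n \<Longrightarrow> Lcm (set_mset P) > 0"
  by (auto simp: Lcm_0_iff int_partitions_def intro!: Nat.gr0I)

context
  fixes n :: nat and P :: "nat multiset" and c :: "(nat \<times> nat) list"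
  assumes P: "P \<in> int_partitions n" and c: "c \<in> permutations_of_multiset (cells P)"
begin

lemma map_shift_mod: "map (shift (m mod Lcm (set_mset P))) c = map (shift m) c"
  by (rule map_cong[OF refl], rule shift_mod) (auto simp: set_permutation_of_cells[OF c])

lemma orbit_eq: "orbit c = (\<lambda>m. map (shift m) c) ` {..<Lcm (set_mset P)}"
proof -
  have "map (shift m) c \<in> (\<lambda>m. map (shift m) c) ` {..<Lcm (set_mset P)}" for m
    using map_shift_mod[of m] Lcm_parts_pos[OF P] by (metis image_eqI lessThan_iff mod_less_divisor)
  then show ?thesis by (auto simp: orbit_def)
qed

lemma card_orbit: "card (orbit c) = Lcm (set_mset P)"
proof -
  let ?L = "Lcm (set_mset P)"
  have "inj_on (\<lambda>m. map (shift m) c) {..<?L}"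
  proof (rule linorder_inj_onI')
    fix m m' assume m: "m \<in> {..<?L}" "m' \<in> {..<?L}" "m < m'"
    show "map (shift m) c \<noteq> map (shift m') c"
    proof
      assume eq: "map (shift m) c = map (shift m') c"
      have "j dvd m' - m" if j: "j \<in># P" for j
      proof -
        \<comment> \<open>A part \<open>j\<close> is positive, so the cell \<open>(j, 0)\<close>
          occurs in \<open>c\<close>; comparing the two shifts there yields a congruence modulo
          \<open>j\<close>.\<close>
        have "(j, 0) \<in> set c" using j P by (auto simp: set_permutation_of_cells[OF c] int_partitions_def)
        then have "shift m (j, 0) = shift m' (j, 0)" using eq by simp
        then have "m' mod j = m mod j" by (simp add: shift_def)
        then show ?thesis using m by (simp add: mod_eq_dvd_iff_nat)
      qed
      then have "?L dvd m' - m" by (rule Lcm_least)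
      then show False using m by (auto dest!: dvd_imp_le)
    qed
  qed
  then show ?thesis by (simp add: orbit_eq card_image)
qed

text \<open>A shift permutes the finite set of cells and preserves the block length, on which alone
  the multiplicity of a cell depends.\<close>

lemma orbit_subset: "orbit c \<subseteq> permutations_of_multiset (cells P)"
proof -
  have "mset (map (shift m) c) = cells P" for m
  proof -
    let ?A = "Sigma (set_mset P) (\<lambda>j. {..<j})"
    have inj: "inj_on (shift m) ?A"
    proof (rule inj_onI)
      fix p q assume "p \<in> ?A" "q \<in> ?A" "shift m p = shift m q"
      then show "p = q"
        using cong_add_rcancel_nat[of "snd p" m "snd q" "fst p"] by (auto simp: shift_def cong_def)
    qed
    have "shift m ` ?A \<subseteq> ?A" by (auto simp: shift_def int_partitions_def)
    then have bij: "shift m ` ?A = ?A" using inj by (simp add: endo_inj_surj)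
    show ?thesis
    proof (rule multiset_eqI)
      fix q
      have mc: "mset c = cells P" using c by (simp add: permutations_of_multiset_def)
      show "count (mset (map (shift m) c)) q = count (cells P) q"
      proof (cases "q \<in> ?A")
        case True
        then obtain p where p: "p \<in> ?A" "q = shift m p" using bij by blast
        have "{x \<in> ?A. shift m p = shift m x} = {p}" using inj p by (auto simp: inj_on_def)
        then have "count (image_mset (shift m) (cells P)) (shift m p) = count (cells P) p"
          by (simp add: count_image_mset' set_mset_cells)
        also have "\<dots> = count (cells P) q"
          using p by (cases p) (auto simp: shift_def count_cells)
        finally show ?thesis by (simp add: mc p)
      next
        case False
        then have "q \<notin># cells P" "q \<notin># mset (map (shift m) c)"
          using bij by (auto simp: set_mset_cells set_permutation_of_cells[OF c])
        then show ?thesis by (metis not_in_iff)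
      qed
    qed
  qed
  then show ?thesis by (auto simp: orbit_def permutations_of_multiset_def)
qed

lemma orbit_eqI:
  assumes "d \<in> orbit c"
  shows "orbit d = orbit c"
proof -
  obtain m where m: "d = map (shift m) c" using assms by (auto simp: orbit_def)
  have comp: "map (shift k) d = map (shift (m + k)) c" for k
    by (simp add: m shift_shift)
  have "map (shift k) c \<in> orbit d" for k
  proof -
    let ?L = "Lcm (set_mset P)"
    have "?L > 0" by (rule Lcm_parts_pos[OF P])
    \<comment> \<open>A further shift by \<open>m * (?L - 1)\<close> undoes the shift by
      \<open>m\<close>, because the two add up to \<open>m * ?L\<close>; this is the inverse
      expressed in natural numbers.\<close>
    then have "k + m * ?L = m + (k + m * (?L - 1))"
      by (cases ?L) (auto simp: algebra_simps)
    then have "map (shift k) c = map (shift (m + (k + m * (?L - 1)))) c"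
      by (metis map_shift_mod mod_mult_self1)
    then show ?thesis unfolding orbit_def by (metis comp rangeI)
  qed
  then show ?thesis using comp by (auto simp: orbit_def)
qed

end

lemma orbit_refl:
  assumes "P \<in> int_partitions n" "c \<in> permutations_of_multiset (cells P)"
  shows "c \<in> orbit c"
proof -
  have "map (shift 0) c = c"
    by (rule map_idI) (auto simp: set_permutation_of_cells[OF assms(2)] shift_def)
  then show ?thesis unfolding orbit_def by (metis rangeI)
qed

text \<open>Orbits sharing an element coincide, so they partition the arrangements into classes of
  equal size.\<close>

lemma card_orbits:
  assumes "P \<in> int_partitions n"
  shows "card (permutations_of_multiset (cells P)) =
    card (orbit ` permutations_of_multiset (cells P)) * Lcm (set_mset P)"
proof -
  let ?C = "permutations_of_multiset (cells P)"
  have un: "\<Union> (orbit ` ?C) = ?C"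
  proof
    show "\<Union> (orbit ` ?C) \<subseteq> ?C" using orbit_subset[OF assms] by auto
    show "?C \<subseteq> \<Union> (orbit ` ?C)" using orbit_refl[OF assms] by auto
  qed
  have "Lcm (set_mset P) * card (orbit ` ?C) = card (\<Union> (orbit ` ?C))"
  proof (rule card_partition)
    fix A B assume AB: "A \<in> orbit ` ?C" "B \<in> orbit ` ?C" "A \<noteq> B"
    have eq: "orbit d = D" if "D \<in> orbit ` ?C" "d \<in> D" for D d
      using that orbit_eqI[OF assms] by auto
    have False if "d \<in> A" "d \<in> B" for d
      using eq[OF AB(1) that(1)] eq[OF AB(2) that(2)] AB(3) by simp
    then show "A \<inter> B = {}" by auto
  qed (auto simp: un card_orbit[OF assms])
  then show ?thesis by (simp add: un mult.commute)
qed

section \<open>Counting the equivalence classes\<close>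

text \<open>With \<open>R\<close> the kernel of \<open>g\<close> on \<open>A\<close>, the classes
  are the nonempty fibres of \<open>g\<close>, one for each value taken.\<close>

lemma card_quotient_eq_card_image:
  assumes "R \<subseteq> A \<times> A" "\<And>x y. x \<in> A \<Longrightarrow> y \<in> A \<Longrightarrow> (x, y) \<in> R \<longleftrightarrow> g x = g y"
  shows "card (A // R) = card (g ` A)"
proof -
  have R: "R `` {x} = {y \<in> A. g y = g x}" if "x \<in> A" for x using assms that by auto
  have "bij_betw (\<lambda>v. {y \<in> A. g y = v}) (g ` A) (A // R)"
    unfolding bij_betw_def
  proof
    show "inj_on (\<lambda>v. {y \<in> A. g y = v}) (g ` A)" by (rule inj_onI) blast
    show "(\<lambda>v. {y \<in> A. g y = v}) ` g ` A = A // R"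
      by (auto simp: quotient_def R image_image)
  qed
  then show ?thesis by (simp add: bij_betw_same_card)
qed

text \<open>Makes the orbit of the code a complete invariant of a class. The two codes may a priori
  belong to different partitions: \<open>orbit_eqI\<close> uses only that of the first,
  \<open>orbit_refl\<close> only that of the second.\<close>

lemma equiv_star_iff:
  assumes "\<mu> \<in> BP n" "\<mu>' \<in> BP n"
  shows "(\<mu>, \<mu>') \<in> equiv_star n \<longleftrightarrow> orbit (code n \<mu>) = orbit (code n \<mu>')"
proof -
  obtain P where P: "P \<in> int_partitions n" "code n \<mu> \<in> permutations_of_multiset (cells P)"
    using code_in_permutations assms by blast
  obtain P' where P': "P' \<in> int_partitions n" "code n \<mu>' \<in> permutations_of_multiset (cells P')"
    using code_in_permutations assms by blast
  have "\<phi> \<mu>' \<noteq> []" using length_phi_pos[OF assms(2)] by auto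
  then have "(\<mu>, \<mu>') \<in> equiv_star n \<longleftrightarrow> (\<exists>m. \<phi> \<mu> = rotate m (\<phi> \<mu>'))"
    using assms ex_circ_shift_iff by (simp add: equiv_star_def)
  also have "\<dots> \<longleftrightarrow> code n \<mu>' \<in> orbit (code n \<mu>)"
    using phi_rotate_iff[OF assms] by (auto simp: orbit_def)
  also have "\<dots> \<longleftrightarrow> orbit (code n \<mu>) = orbit (code n \<mu>')"
    using orbit_eqI[OF P] orbit_refl[OF P'] by auto
  finally show ?thesis .
qed

text \<open>The count splits into a sum because orbits for different partitions never coincide: an
  orbit stays inside the arrangements of one multiset of cells, and this multiset determines the
  partition.\<close>

lemma card_BP_star:
  "card (BP_star n) = (\<Sum>P\<in>int_partitions n. card (orbit ` permutations_of_multiset (cells P)))"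
proof -
  let ?C = "\<lambda>P. permutations_of_multiset (cells P)"
  have "card (BP_star n) = card ((\<lambda>\<mu>. orbit (code n \<mu>)) ` BP n)"
    unfolding BP_star_def
    by (rule card_quotient_eq_card_image) (auto simp: equiv_star_iff, auto simp: equiv_star_def)
  also have "(\<lambda>\<mu>. orbit (code n \<mu>)) ` BP n = (\<Union>P\<in>int_partitions n. orbit ` ?C P)"
    by (simp only: image_image[of orbit "code n", symmetric] code_image_BP image_UN)
  also have "card \<dots> = (\<Sum>P\<in>int_partitions n. card (orbit ` ?C P))"
  proof (rule card_UN_disjoint[OF finite_int_partitions]; intro ballI impI)
    fix P Q assume PQ: "P \<in> int_partitions n" "Q \<in> int_partitions n" "P \<noteq> Q"
    show "orbit ` ?C P \<inter> orbit ` ?C Q = {}"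
    proof (rule ccontr)
      assume "orbit ` ?C P \<inter> orbit ` ?C Q \<noteq> {}"
      then obtain c d where cd: "c \<in> ?C P" "d \<in> ?C Q" "orbit c = orbit d" by blast
      have "c \<in> orbit d" using orbit_refl[OF PQ(1) cd(1)] cd(3) by simp
      then have "c \<in> ?C Q" using orbit_subset[OF PQ(2) cd(2)] by (rule subsetD[rotated])
      then have "cells P = cells Q" using cd by (simp add: permutations_of_multiset_def)
      then show False using PQ cells_inj_on by (auto dest: inj_onD)
    qed
  qed auto
  finally show ?thesis .
qed

theorem theorem4:
  fixes n :: nat
  assumes "n \<ge> 1"
  shows "real (card (BP_star n)) =
    (\<Sum>P\<in>int_partitions n.
       fact n / (\<Prod>j=1..Max (set_mset P). fact (count P j) ^ j)
         * (1 / real (Lcm {j \<in> {1..Max (set_mset P)}. count P j \<ge> 1})))"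
  unfolding card_BP_star of_nat_sum
proof (rule sum.cong[OF refl])
  fix P assume P: "P \<in> int_partitions n"
  let ?C = "permutations_of_multiset (cells P)"
  have parts: "{j \<in> {1..Max (set_mset P)}. count P j \<ge> 1} = set_mset P"
  proof (intro set_eqI iffI)
    fix j assume "j \<in># P"
    moreover from this have "j > 0" using P by (simp add: int_partitions_def)
    ultimately show "j \<in> {j \<in> {1..Max (set_mset P)}. count P j \<ge> 1}" by simp
  qed simp
  \<comment> \<open>Sizes that do not occur in \<open>P\<close> contribute the factor
    \<open>fact 0 ^ j = 1\<close>.\<close>
  have "(\<Prod>j=1..Max (set_mset P). fact (count P j) ^ j :: real) =
      (\<Prod>j\<in>set_mset P. fact (count P j) ^ j)"
  proof (rule prod.mono_neutral_right)
    show "set_mset P \<subseteq> {1..Max (set_mset P)}" by (subst parts[symmetric]) (rule Collect_subset)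
  qed (auto simp: not_in_iff)
  moreover have "real (card ?C) = fact n / (\<Prod>j\<in>set_mset P. fact (count P j) ^ j)"
    using P by (simp add: card_permutations_of_cells int_partitions_def)
  moreover have "real (card (orbit ` ?C)) = real (card ?C) * (1 / real (Lcm (set_mset P)))"
    using P by (auto simp: card_orbits[OF P] int_partitions_def)
  ultimately show "real (card (orbit ` ?C)) =
      fact n / (\<Prod>j=1..Max (set_mset P). fact (count P j) ^ j)
        * (1 / real (Lcm {j \<in> {1..Max (set_mset P)}. count P j \<ge> 1}))"
    unfolding parts by presburger
qed

end
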